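(* Let $n\ge 3$ and let $S_n^2 = K_n\vee\overline{K_2}$ be the complete split graph. Then the all-negative signature maximises the frustration index of $S_n^2$ uniquely, and \[ l_{\max}(S_n^2) = l(-S_n^2) = \left\lfloor \frac{(n-1)^2}{4} + n - 1\right\rfloor . \]
   Context: All graphs are finite, simple and undirected. A signed graph $\Sigma=(G,\sigma)$ is a graph $G$ with a signature $\sigma:E(G)\to\{+1,-1\}$. The sign of a cycle is the product of the signs of its edges; $\Sigma$ is balanced if all its cycles are positive. The frustration index $l(\Sigma)$ is the minimum number of edges whose deletion makes $\Sigma$ balanced. $-G$ is $G$ with all edges signed $-1$. $l_{\max}(G)=\max_\sigma l(G,\sigma)$. Switching $\Sigma$ at a vertex subset $X$ negates the signs of all edges with exactly one endpoint in $X$; two signatures are switching equivalent if one is obtained from the other by switching. The all-negative signature maximises the frustration index of $G$ uniquely if $l(-G)=l_{\max}(G)$ and every $\sigma$ with $l(G,\sigma)=l_{\max}(G)$ is switching equivalent to the all-negative signature. $\overline{K_m}$ is the edgeless graph on $m$ vertices and $\vee$ denotes the join. *)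

theory Defs
  imports Complex_Main
begin

record 'a graph =
  verts :: "'a set"
  edges :: "'a set set"

definition simple_graph :: "'a graph \<Rightarrow> bool" where
  "simple_graph G \<longleftrightarrow> finite (verts G) \<and> (\<forall>e\<in>edges G. e \<subseteq> verts G \<and> card e = 2)"

definition complete_graph :: "nat \<Rightarrow> nat graph" where
  "complete_graph n = \<lparr>verts = {..<n}, edges = {e. e \<subseteq> {..<n} \<and> card e = 2}\<rparr>"

definition edgeless_graph :: "nat \<Rightarrow> nat graph" where
  "edgeless_graph m = \<lparr>verts = {..<m}, edges = {}\<rparr>"

definition join :: "'a graph \<Rightarrow> 'b graph \<Rightarrow> ('a + 'b) graph" where
  "join G H =
     \<lparr>verts = verts G <+> verts H,
      edges = (\<lambda>e. Inl ` e) ` edges G \<union> (\<lambda>e. Inr ` e) ` edges H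
                \<union> {{Inl u, Inr v} | u v. u \<in> verts G \<and> v \<in> verts H}\<rparr>"

definition complete_split_graph :: "nat \<Rightarrow> nat \<Rightarrow> (nat + nat) graph" where
  "complete_split_graph n s = join (complete_graph n) (edgeless_graph s)"

lemma simple_graph_complete_split_graph: "simple_graph (complete_split_graph n s)"
  by (auto simp: simple_graph_def complete_split_graph_def join_def complete_graph_def
      edgeless_graph_def card_image)

text \<open>A cycle is given by the list of its vertices in cyclic order. Since there are at least
  three of them and they are distinct, the edges listed in \<open>cycle_edges\<close> are pairwise distinct,
  so products over this set count every edge of the cycle once.\<close>

definition cycle_edges :: "'a list \<Rightarrow> 'a set set" where
  "cycle_edges vs = {{vs ! i, vs ! (Suc i mod length vs)} | i. i < length vs}"

definition is_cycle :: "'a graph \<Rightarrow> 'a list \<Rightarrow> bool" where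
  "is_cycle G vs \<longleftrightarrow> 3 \<le> length vs \<and> distinct vs \<and> set vs \<subseteq> verts G \<and> cycle_edges vs \<subseteq> edges G"

text \<open>Signatures are total functions on vertex sets; their values outside \<open>edges G\<close> are
  arbitrary, and no notion below depends on them.\<close>

definition signature :: "'a graph \<Rightarrow> ('a set \<Rightarrow> int) \<Rightarrow> bool" where
  "signature G \<sigma> \<longleftrightarrow> (\<forall>e\<in>edges G. \<sigma> e \<in> {1, -1})"

definition all_negative :: "'a set \<Rightarrow> int" where
  "all_negative = (\<lambda>e. -1)"

definition cycle_sign :: "('a set \<Rightarrow> int) \<Rightarrow> 'a list \<Rightarrow> int" where
  "cycle_sign \<sigma> vs = (\<Prod>e\<in>cycle_edges vs. \<sigma> e)"

definition balanced :: "'a graph \<Rightarrow> ('a set \<Rightarrow> int) \<Rightarrow> bool" where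
  "balanced G \<sigma> \<longleftrightarrow> (\<forall>vs. is_cycle G vs \<longrightarrow> cycle_sign \<sigma> vs = 1)"

definition delete_edges :: "'a graph \<Rightarrow> 'a set set \<Rightarrow> 'a graph" where
  "delete_edges G F = G\<lparr>edges := edges G - F\<rparr>"

definition frustration_index :: "'a graph \<Rightarrow> ('a set \<Rightarrow> int) \<Rightarrow> nat" where
  "frustration_index G \<sigma> = Min {card F | F. F \<subseteq> edges G \<and> balanced (delete_edges G F) \<sigma>}"

definition max_frustration_index :: "'a graph \<Rightarrow> nat" where
  "max_frustration_index G = Max {frustration_index G \<sigma> | \<sigma>. signature G \<sigma>}"

definition switch :: "'a set \<Rightarrow> ('a set \<Rightarrow> int) \<Rightarrow> ('a set \<Rightarrow> int)" where
  "switch X \<sigma> = (\<lambda>e. if card (e \<inter> X) = 1 then - \<sigma> e else \<sigma> e)"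

definition switching_equivalent ::
  "'a graph \<Rightarrow> ('a set \<Rightarrow> int) \<Rightarrow> ('a set \<Rightarrow> int) \<Rightarrow> bool" where
  "switching_equivalent G \<sigma> \<tau> \<longleftrightarrow>
     (\<exists>X\<subseteq>verts G. \<forall>e\<in>edges G. \<tau> e = switch X \<sigma> e)"

definition all_negative_maximises_uniquely :: "'a graph \<Rightarrow> bool" where
  "all_negative_maximises_uniquely G \<longleftrightarrow>
     frustration_index G all_negative = max_frustration_index G \<and>
     (\<forall>\<sigma>. signature G \<sigma> \<and> frustration_index G \<sigma> = max_frustration_index G \<longrightarrow>
          switching_equivalent G \<sigma> all_negative)"

end

theory Submission
  imports Defs
begin

text \<open>For the upper bound, delete a vertex of the clique and put it back on the better side of a
  switching set: this frustrates at most half of its incident edges. Those increments add up to exactly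
  the claimed value, so a signature attaining it also attains the maximum after deleting any clique
  vertex. Since for \<open>n \<ge> 4\<close> every triangle avoids some clique vertex, induction from \<open>n = 3\<close> shows that
  all triangles are negative; as a clique vertex is adjacent to everything, switching then makes all
  edges negative. The lower bound for the all-negative
  signature is Mantel's theorem: deleting a frustration set leaves a triangle-free graph.\<close>

section \<open>Switching and balance\<close>

text \<open>Each \<open>X\<close> yields an edge set whose deletion balances the graph, so a good
  choice of \<open>X\<close> bounds the frustration index from above. A bare edge set
  \<open>E\<close> replaces the graph because the induction removes vertices.\<close>

definition frustrated_edges :: "'a set set \<Rightarrow> ('a set \<Rightarrow> int) \<Rightarrow> 'a set \<Rightarrow> 'a set set" where
  "frustrated_edges E \<sigma> X = {e \<in> E. switch X \<sigma> e = -1}"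

lemma switch_edge:
  assumes "p \<noteq> q"
  shows "switch X \<sigma> {p, q} = (if (p \<in> X) = (q \<in> X) then \<sigma> {p, q} else - \<sigma> {p, q})"
proof -
  have "{p, q} \<inter> X = (if p \<in> X then {p} else {}) \<union> (if q \<in> X then {q} else {})"
    by auto
  then show ?thesis
    using assms by (auto simp: switch_def)
qed

lemma switch_sign: "\<sigma> e \<in> {1, -1} \<Longrightarrow> switch X \<sigma> e \<in> {1, -1}"
  by (auto simp: switch_def)

lemma Suc_mod_eq_iff:
  assumes "i < n" "j < n"
  shows "Suc i mod n = Suc j mod n \<longleftrightarrow> i = j"
  using assms by (auto simp: mod_Suc)

text \<open>If two positions gave the same edge, each would be the successor of the other modulo the
  length, which is impossible for length at least 3. Products over \<open>cycle_edges\<close> can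
  therefore run over positions.\<close>

lemma inj_on_cycle_edge:
  assumes "3 \<le> length vs" "distinct vs"
  shows "inj_on (\<lambda>i. {vs ! i, vs ! (Suc i mod length vs)}) {..<length vs}"
proof (rule inj_onI)
  fix i j
  let ?n = "length vs"
  assume ij: "i \<in> {..<?n}" "j \<in> {..<?n}"
    and eq: "{vs ! i, vs ! (Suc i mod ?n)} = {vs ! j, vs ! (Suc j mod ?n)}"
  have lt: "i < ?n" "j < ?n" "Suc i mod ?n < ?n" "Suc j mod ?n < ?n"
    using ij assms(1) by (auto intro!: mod_less_divisor)
  show "i = j"
  proof (rule ccontr)
    assume "i \<noteq> j"
    then have "i = Suc j mod ?n" "j = Suc i mod ?n"
      using eq lt assms(2) by (auto simp: doubleton_eq_iff nth_eq_iff_index_eq)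
    then show False
      using lt assms(1) by (auto simp: mod_Suc split: if_splits)
  qed
qed

lemma cycle_sign_eq_prod:
  assumes "3 \<le> length vs" "distinct vs"
  shows "cycle_sign \<sigma> vs = (\<Prod>i<length vs. \<sigma> {vs ! i, vs ! (Suc i mod length vs)})"
proof -
  have "cycle_edges vs = (\<lambda>i. {vs ! i, vs ! (Suc i mod length vs)}) ` {..<length vs}"
    by (auto simp: cycle_edges_def)
  then show ?thesis
    using prod.reindex[OF inj_on_cycle_edge[OF assms]] by (simp add: cycle_sign_def)
qed

text \<open>Give each vertex the sign \<open>t\<close>, negative exactly on \<open>X\<close>. The
  sign of an edge is the product of its end signs, and around a cycle every vertex contributes its
  sign twice.\<close>

lemma balanced_if_switch_positive:
  assumes pos: "\<And>e. e \<in> edges G \<Longrightarrow> switch X \<sigma> e = 1"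
  shows "balanced G \<sigma>"
  unfolding balanced_def
proof (intro allI impI)
  fix vs assume cyc: "is_cycle G vs"
  let ?n = "length vs"
  define t where "t v = (if v \<in> X then -1 else (1::int))" for v
  have vs: "3 \<le> ?n" "distinct vs" "cycle_edges vs \<subseteq> edges G"
    using cyc by (auto simp: is_cycle_def)
  have edge: "\<sigma> {vs ! i, vs ! (Suc i mod ?n)} = t (vs ! i) * t (vs ! (Suc i mod ?n))"
    if i: "i < ?n" for i
  proof -
    have "Suc i mod ?n < ?n" "i \<noteq> Suc i mod ?n"
      using i vs(1) by (auto simp: mod_Suc)
    then have "vs ! i \<noteq> vs ! (Suc i mod ?n)"
      using i vs(2) by (auto simp: nth_eq_iff_index_eq)
    moreover have "switch X \<sigma> {vs ! i, vs ! (Suc i mod ?n)} = 1"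
      using i vs(3) by (intro pos) (auto simp: cycle_edges_def)
    ultimately show ?thesis
      by (auto simp: switch_edge t_def split: if_splits)
  qed
  \<comment> \<open>Moving to the next position permutes the positions, so second endpoints
    contribute the same product as first endpoints.\<close>
  have inj: "inj_on (\<lambda>i. Suc i mod ?n) {..<?n}"
    by (auto simp: inj_on_def Suc_mod_eq_iff)
  have "(\<lambda>i. Suc i mod ?n) ` {..<?n} \<subseteq> {..<?n}"
    by (auto intro!: mod_less_divisor)
  then have "(\<lambda>i. Suc i mod ?n) ` {..<?n} = {..<?n}"
    using inj by (intro endo_inj_surj) auto
  then have "(\<Prod>i<?n. t (vs ! (Suc i mod ?n))) = (\<Prod>i<?n. t (vs ! i))"
    using prod.reindex[OF inj, of "\<lambda>j. t (vs ! j)"] by simp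
  moreover have "t v * t v = 1" for v
    by (simp add: t_def)
  ultimately show "cycle_sign \<sigma> vs = 1"
    using edge by (simp add: cycle_sign_eq_prod[OF vs(1,2)] prod.distrib
        flip: prod.distrib[of "\<lambda>i. t (vs ! i)" "\<lambda>i. t (vs ! i)"])
qed

lemma finite_frustration_set:
  assumes "finite (edges G)"
  shows "finite {card F | F. F \<subseteq> edges G \<and> balanced (delete_edges G F) \<sigma>}"
proof -
  have "{card F | F. F \<subseteq> edges G \<and> balanced (delete_edges G F) \<sigma>} \<subseteq> card ` Pow (edges G)"
    by auto
  then show ?thesis
    using assms by (meson finite_Pow_iff finite_imageI finite_subset)
qed

lemma balanced_delete_frustrated_edges:
  assumes "signature G \<sigma>"
  shows "balanced (delete_edges G (frustrated_edges (edges G) \<sigma> X)) \<sigma>"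
proof (rule balanced_if_switch_positive)
  fix e assume "e \<in> edges (delete_edges G (frustrated_edges (edges G) \<sigma> X))"
  then show "switch X \<sigma> e = 1"
    using assms switch_sign[of \<sigma> e X]
    by (auto simp: delete_edges_def frustrated_edges_def signature_def)
qed

lemma frustration_index_le:
  assumes "finite (edges G)" "signature G \<sigma>"
  shows "frustration_index G \<sigma> \<le> card (frustrated_edges (edges G) \<sigma> X)"
  unfolding frustration_index_def
  using balanced_delete_frustrated_edges[OF assms(2), of X] finite_frustration_set[OF assms(1)]
  by (intro Min_le) (auto simp: frustrated_edges_def intro!: exI[of _ "frustrated_edges (edges G) \<sigma> X"])

lemma frustration_index_attained:
  assumes "finite (edges G)" "signature G \<sigma>"
  obtains F where "F \<subseteq> edges G" "balanced (delete_edges G F) \<sigma>" "frustration_index G \<sigma> = card F"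
proof -
  let ?S = "{card F | F. F \<subseteq> edges G \<and> balanced (delete_edges G F) \<sigma>}"
  \<comment> \<open>Deleting all negative edges balances the graph, so the set under
    \<open>Min\<close> is nonempty.\<close>
  have "card (frustrated_edges (edges G) \<sigma> {}) \<in> ?S"
    using balanced_delete_frustrated_edges[OF assms(2), of "{}"]
    by (auto simp: frustrated_edges_def intro!: exI[of _ "frustrated_edges (edges G) \<sigma> {}"])
  then have "Min ?S \<in> ?S"
    using finite_frustration_set[OF assms(1)] by (intro Min_in) auto
  then show ?thesis
    using that by (auto simp: frustration_index_def)
qed

section \<open>Mantel's theorem\<close>

text \<open>Remove both ends of an edge \<open>{u, v}\<close>. Every other vertex is adjacent to at
  most one of them, so at most \<open>card ?W + 1\<close> edges disappear, and
  \<open>(card ?W)^2 + 4 * card ?W + 4\<close> is the square of \<open>card ?W + 2\<close>.\<close>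

lemma mantel:
  assumes "finite V" "\<And>e. e \<in> E \<Longrightarrow> e \<subseteq> V \<and> card e = 2"
    and "\<And>p q r. {p, q} \<in> E \<Longrightarrow> {q, r} \<in> E \<Longrightarrow> {p, r} \<notin> E"
  shows "4 * card E \<le> (card V)\<^sup>2"
  using assms
proof (induction "card V" arbitrary: V E rule: less_induct)
  case less
  show ?case
  proof (cases "E = {}")
    case False
    then obtain e where e: "e \<in> E" by auto
    then obtain u v where uv: "e = {u, v}" "u \<noteq> v"
      using less.prems(2)[OF e] by (auto simp: card_2_iff)
    have uvV: "u \<in> V" "v \<in> V"
      using less.prems(2)[OF e] uv by auto
    let ?W = "V - {u, v}"
    let ?E' = "{f \<in> E. f \<inter> {u, v} = {}}"
    \<comment> \<open>The only edge that can join \<open>w\<close> to \<open>u\<close> or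
      \<open>v\<close>. If there is none, the value is a non-edge, which does no harm to an upper
      bound.\<close>
    let ?h = "\<lambda>w. if {u, w} \<in> E then {u, w} else {v, w}"
    have "card {u, v} = 2"
      using uv by simp
    moreover have "card {u, v} \<le> card V"
      using uvV less.prems(1) by (intro card_mono) auto
    ultimately have cW: "card V = card ?W + 2"
      using uvV by (simp add: card_Diff_subset)
    have finE: "finite E"
      using less.prems(1,2) by (meson Pow_iff finite_Pow_iff rev_finite_subset subsetI)
    have IH: "4 * card ?E' \<le> (card ?W)\<^sup>2"
    proof (rule less.hyps)
      fix f assume "f \<in> ?E'"
      then show "f \<subseteq> ?W \<and> card f = 2"
        using less.prems(2)[of f] by auto
    next
      fix p q r assume "{p, q} \<in> ?E'" "{q, r} \<in> ?E'"
      then show "{p, r} \<notin> ?E'"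
        using less.prems(3)[of p q r] by auto
    qed (use less.prems(1) cW in auto)
    have "f \<in> ?E' \<union> insert {u, v} (?h ` ?W)" if f: "f \<in> E" for f
    proof -
      obtain p q where pq: "f = {p, q}" "p \<noteq> q" "p \<in> V" "q \<in> V"
        using less.prems(2)[OF f] by (auto simp: card_2_iff)
      have *: "{u, v} \<in> E" using e uv by simp
      have "{u, w} \<notin> E" if "{v, w} \<in> E" for w
        using less.prems(3)[OF * that] .
      then show ?thesis
        using f pq uv(2) by (auto simp: insert_commute image_iff)
    qed
    then have "card E \<le> card (?E' \<union> insert {u, v} (?h ` ?W))"
      using less.prems(1) finE by (intro card_mono) auto
    also have "\<dots> \<le> card ?E' + card (insert {u, v} (?h ` ?W))"
      by (rule card_Un_le)
    also have "card (insert {u, v} (?h ` ?W)) \<le> Suc (card (?h ` ?W))"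
      by (rule card_insert_le_m1) auto
    also have "card (?h ` ?W) \<le> card ?W"
      using less.prems(1) by (intro card_image_le) auto
    finally have "4 * card E \<le> 4 * card ?E' + 4 * card ?W + 4"
      by simp
    then show ?thesis
      using IH by (simp add: cW power2_eq_square algebra_simps)
  qed simp
qed

section \<open>Complete split graphs\<close>

text \<open>For disjoint \<open>A\<close> and \<open>B\<close> this is the complete split graph with
  clique \<open>A\<close> and independent set \<open>B\<close>, freed from the sum type so that
  clique vertices can be removed one at a time.\<close>

definition split_edges :: "'a set \<Rightarrow> 'a set \<Rightarrow> 'a set set" where
  "split_edges A B = {e. e \<subseteq> A \<union> B \<and> card e = 2 \<and> \<not> e \<subseteq> B}"

lemma doubleton_in_split_edges:
  "{p, q} \<in> split_edges A B \<longleftrightarrow>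
    p \<noteq> q \<and> p \<in> A \<union> B \<and> q \<in> A \<union> B \<and> \<not> (p \<in> B \<and> q \<in> B)"
  by (auto simp: split_edges_def card_insert_if)

lemma split_edgesE:
  assumes "e \<in> split_edges A B"
  obtains p q where "e = {p, q}" "p \<noteq> q" "p \<in> A - B" "q \<in> A \<union> B"
proof -
  obtain p q where "e = {p, q}" "p \<noteq> q"
    using assms by (auto simp: split_edges_def card_2_iff)
  then show ?thesis
    using assms that[of p q] that[of q p] by (auto simp: split_edges_def)
qed

lemma finite_split_edges: "finite A \<Longrightarrow> finite B \<Longrightarrow> finite (split_edges A B)"
  by (rule finite_subset[of _ "Pow (A \<union> B)"]) (auto simp: split_edges_def)

lemma split_edges_insert:
  assumes "u \<notin> A" "u \<notin> B"
  shows "split_edges (insert u A) B = split_edges A B \<union> (\<lambda>w. {u, w}) ` (A \<union> B)"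
proof (intro equalityI subsetI)
  fix e assume "e \<in> split_edges (insert u A) B"
  then obtain p q where "e = {p, q}" "p \<noteq> q" "p \<in> insert u A - B" "q \<in> insert u A \<union> B"
    by (rule split_edgesE)
  then show "e \<in> split_edges A B \<union> (\<lambda>w. {u, w}) ` (A \<union> B)"
    using assms by (auto simp: doubleton_in_split_edges)
next
  fix e assume "e \<in> split_edges A B \<union> (\<lambda>w. {u, w}) ` (A \<union> B)"
  then show "e \<in> split_edges (insert u A) B"
    using assms by (auto simp: doubleton_in_split_edges) (auto simp: split_edges_def)
qed

text \<open>The only pair missing from the complete graph on \<open>A \<union> B\<close> is
  \<open>B\<close> itself.\<close>

lemma card_split_edges:
  assumes "finite A" "A \<inter> B = {}" "card B = 2"
  shows "card (split_edges A B) = ((card A + 2) choose 2) - 1"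
proof -
  have B: "finite B"
    using assms(3) by (simp add: card_ge_0_finite)
  have "e = B" if "e \<subseteq> B" "card e = 2" for e
    using that B assms(3) by (simp add: card_subset_eq)
  then have "split_edges A B = {e. e \<subseteq> A \<union> B \<and> card e = 2} - {B}"
    using assms(3) by (auto simp: split_edges_def)
  moreover have "B \<in> {e. e \<subseteq> A \<union> B \<and> card e = 2}"
    using assms(3) by auto
  ultimately show ?thesis
    using assms B by (simp add: n_subsets card_Un_disjoint)
qed

lemma edges_complete_split_graph:
  "edges (complete_split_graph n s) = split_edges (Inl ` {..<n}) (Inr ` {..<s})"
proof (intro equalityI subsetI)
  fix e assume "e \<in> edges (complete_split_graph n s)"
  then show "e \<in> split_edges (Inl ` {..<n}) (Inr ` {..<s})"
    by (auto simp: complete_split_graph_def join_def complete_graph_def edgeless_graph_def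
        doubleton_in_split_edges card_2_iff)
next
  fix e :: "(nat + nat) set" assume "e \<in> split_edges (Inl ` {..<n}) (Inr ` {..<s})"
  then obtain p q where e: "e = {p, q}" "p \<noteq> q" "p \<in> Inl ` {..<n} - Inr ` {..<s}"
    "q \<in> Inl ` {..<n} \<union> Inr ` {..<s}"
    by (rule split_edgesE)
  then obtain i where i: "p = Inl i" "i < n" by auto
  show "e \<in> edges (complete_split_graph n s)"
  proof (cases q)
    case (Inl j)
    then have "{i, j} \<in> {e. e \<subseteq> {..<n} \<and> card e = 2}" "e = Inl ` {i, j}"
      using e i by auto
    then show ?thesis
      unfolding complete_split_graph_def join_def complete_graph_def by (metis (no_types, lifting) Un_iff graph.select_convs(2) imageI)
  next
    case (Inr j)
    then show ?thesis
      using e i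
      by (auto simp: complete_split_graph_def join_def complete_graph_def edgeless_graph_def)
  qed
qed

lemma verts_complete_split_graph:
  "verts (complete_split_graph n s) = Inl ` {..<n} \<union> Inr ` {..<s}"
  by (auto simp: complete_split_graph_def join_def complete_graph_def edgeless_graph_def)

section \<open>Upper bound\<close>

text \<open>The candidates for \<open>Y\<close> are \<open>X\<close> without \<open>u\<close> and
  \<open>X\<close> with \<open>u\<close>. Edges avoiding \<open>u\<close> do not distinguish them,
  while every edge at \<open>u\<close> is frustrated by at most one of them, so one candidate
  frustrates at most half of the star.\<close>

lemma extend_switching:
  assumes "finite A" "finite B" "u \<notin> A" "u \<notin> B"
    and sign: "\<And>e. e \<in> split_edges (insert u A) B \<Longrightarrow> \<sigma> e \<in> {1, -1}"
  shows "\<exists>Y. card (frustrated_edges (split_edges (insert u A) B) \<sigma> Y)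
    \<le> card (frustrated_edges (split_edges A B) \<sigma> X) + card (A \<union> B) div 2"
proof -
  define star where "star = (\<lambda>w. {u, w}) ` (A \<union> B)"
  define X0 where "X0 = X - {u}"
  have E: "split_edges (insert u A) B = split_edges A B \<union> star"
    using assms by (simp add: split_edges_insert star_def)
  have finstar: "finite star"
    using assms by (simp add: star_def)
  have old: "frustrated_edges (split_edges A B) \<sigma> Y = frustrated_edges (split_edges A B) \<sigma> X"
    if "Y - {u} = X0" for Y
  proof -
    have "e \<inter> Y = e \<inter> X" if "e \<in> split_edges A B" for e
      using that \<open>Y - {u} = X0\<close> assms(3,4) by (auto simp: X0_def split_edges_def)
    then show ?thesis
      by (auto simp: frustrated_edges_def switch_def)
  qed
  have new: "card (frustrated_edges (split_edges (insert u A) B) \<sigma> Y)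
      \<le> card (frustrated_edges (split_edges A B) \<sigma> X) + card (frustrated_edges star \<sigma> Y)"
    if "Y - {u} = X0" for Y
  proof -
    have "frustrated_edges (split_edges (insert u A) B) \<sigma> Y
        = frustrated_edges (split_edges A B) \<sigma> Y \<union> frustrated_edges star \<sigma> Y"
      by (auto simp: E frustrated_edges_def)
    then show ?thesis
      using card_Un_le old[OF that] by metis
  qed
  have flip: "switch (insert u X0) \<sigma> e = - switch X0 \<sigma> e" if e: "e \<in> star" for e
  proof -
    obtain w where w: "e = {u, w}" "u \<noteq> w"
      using e assms(3,4) by (auto simp: star_def)
    then show ?thesis
      by (auto simp: switch_edge X0_def)
  qed
  have "card (frustrated_edges star \<sigma> X0) + card (frustrated_edges star \<sigma> (insert u X0))
      = card (frustrated_edges star \<sigma> X0 \<union> frustrated_edges star \<sigma> (insert u X0))"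
    using finstar flip
    by (intro card_Un_disjoint[symmetric]) (auto simp: frustrated_edges_def)
  also have "\<dots> \<le> card star"
    using finstar by (intro card_mono) (auto simp: frustrated_edges_def)
  also have "\<dots> \<le> card (A \<union> B)"
    unfolding star_def using assms by (intro card_image_le) auto
  finally have "card (frustrated_edges star \<sigma> X0) \<le> card (A \<union> B) div 2
      \<or> card (frustrated_edges star \<sigma> (insert u X0)) \<le> card (A \<union> B) div 2"
    by linarith
  moreover have "X0 - {u} = X0" "insert u X0 - {u} = X0"
    by (auto simp: X0_def)
  ultimately show ?thesis
    using new by (meson add_left_mono order_trans)
qed

text \<open>A local substitute for switching equivalence to the all-negative signature: a violation
  is a single triangle and survives the deletion of any other vertex. When \<open>E\<close> consists
  of two-element sets, \<open>p\<close>, \<open>q\<close> and \<open>r\<close> are automatically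
  distinct.\<close>

definition triangles_negative :: "'a set set \<Rightarrow> ('a set \<Rightarrow> int) \<Rightarrow> bool" where
  "triangles_negative E \<sigma> \<longleftrightarrow>
     (\<forall>p q r. {p, q} \<in> E \<and> {q, r} \<in> E \<and> {p, r} \<in> E \<longrightarrow> \<sigma> {p, q} * \<sigma> {q, r} * \<sigma> {p, r} = -1)"


lemma triangle_negativeD:
  assumes "triangles_negative E \<sigma>" "{p, q} \<in> E" "{q, r} \<in> E" "{p, r} \<in> E"
  shows "\<sigma> {p, q} * \<sigma> {q, r} * \<sigma> {p, r} = -1"
  using assms by (auto simp: triangles_negative_def)

text \<open>A triangle has zero or two edges leaving \<open>X\<close>, so switching preserves its
  sign.\<close>

lemma triangles_negative_if_switch:
  assumes "\<And>e. e \<in> E \<Longrightarrow> switch X \<sigma> e = -1" "\<And>e. e \<in> E \<Longrightarrow> card e = 2"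
  shows "triangles_negative E \<sigma>"
  unfolding triangles_negative_def
proof (intro allI impI, elim conjE)
  fix p q r assume E: "{p, q} \<in> E" "{q, r} \<in> E" "{p, r} \<in> E"
  then have "p \<noteq> q" "q \<noteq> r" "p \<noteq> r"
    using assms(2) by fastforce+
  then show "\<sigma> {p, q} * \<sigma> {q, r} * \<sigma> {p, r} = -1"
    using assms(1)[OF E(1)] assms(1)[OF E(2)] assms(1)[OF E(3)]
    by (auto simp: switch_edge split: if_splits)
qed

section \<open>The base case: three clique vertices\<close>

text \<open>In the next three lemmas, the Boolean of an edge says whether it is negative and the
  Boolean \<open>t\<close> of a vertex on which side of the switching set it lies; the edge \<open>pq\<close> is then
  frustrated iff \<open>(t\<^sub>p = t\<^sub>q) = pq\<close>.\<close>

lemma switch_star_bool: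
  fixes ta tb tc ax bx cx :: bool
  shows
  "\<exists>tx. of_bool ((ta = tx) = ax) + of_bool ((tb = tx) = bx) + of_bool ((tc = tx) = cx)
    \<le> (of_bool (\<not> ((ta = tb) = (ax = bx) \<and> (tb = tc) = (bx = cx))) :: nat)"
  \<comment> \<open>The edge from \<open>a\<close> to the new vertex is frustrated iff
    \<open>tx\<close> equals \<open>(ta = ax)\<close>, and likewise for \<open>b\<close> and
    \<open>c\<close>. Taking \<open>tx\<close> opposite to the majority of these three values costs
    0 if they agree and 1 otherwise.\<close>
  by (cases ta; cases tb; cases tc; cases ax; cases bx; cases cx; simp add: ex_bool_eq)

lemma switch_triangle_bool:
  "(\<exists>ta tb tc :: bool. of_bool ((ta = tb) = ab) + of_bool ((ta = tc) = ac) + of_bool ((tb = tc) = bc)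
      + of_bool (\<not> ((ta = tb) = dx \<and> (tb = tc) = ex))
      + of_bool (\<not> ((ta = tb) = dy \<and> (tb = tc) = ey)) \<le> (2 :: nat))
   \<or> (\<exists>ta tb tc :: bool. of_bool ((ta = tb) = ab) + of_bool ((ta = tc) = ac) + of_bool ((tb = tc) = bc)
      + of_bool (\<not> ((ta = tb) = dx \<and> (tb = tc) = ex))
      + of_bool (\<not> ((ta = tb) = dy \<and> (tb = tc) = ey)) \<le> (3 :: nat))
     \<and> ((ab = bc) = ac \<and> ab = dx \<and> bc = ex \<and> ab = dy \<and> bc = ey)"
  \<comment> \<open>Up to complement the triangle has four switchings, and each outer vertex fits
    exactly one of them. A positive triangle has frustration 0 in one switching, for a total of at
    most 2. A negative one has frustrations 1, 1, 1, 3; if some outer vertex fits a switching of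
    frustration 1, the total there is at most 2. Otherwise both fit the one of frustration 3, which
    is the second alternative.\<close>
  by (cases ab; cases ac; cases bc; cases dx; cases ex; cases dy; cases ey; simp add: ex_bool_eq)

lemma switch_S3_bool:
  fixes ab ac bc ax bx cx ay "by" cy :: bool and S :: "nat set"
  assumes S: "\<And>ta tb tc tx ty :: bool.
    of_bool ((ta = tb) = ab) + of_bool ((ta = tc) = ac) + of_bool ((tb = tc) = bc)
    + (of_bool ((ta = tx) = ax) + of_bool ((tb = tx) = bx) + of_bool ((tc = tx) = cx))
    + (of_bool ((ta = ty) = ay) + of_bool ((tb = ty) = by) + of_bool ((tc = ty) = cy)) \<in> S"
  shows "(\<exists>k\<in>S. k \<le> 2) \<or> (\<exists>k\<in>S. k \<le> 3) \<and> 9 \<in> S"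
proof -
  \<comment> \<open>The set \<open>S\<close> contains the frustration count of every choice of
    sides; \<open>r\<close> bounds the count once \<open>tx\<close> and \<open>ty\<close> are chosen
    well for given \<open>ta\<close>, \<open>tb\<close>, \<open>tc\<close>.\<close>
  define r where "r ta tb tc = (of_bool ((ta = tb) = ab) + of_bool ((ta = tc) = ac)
      + of_bool ((tb = tc) = bc) + of_bool (\<not> ((ta = tb) = (ax = bx) \<and> (tb = tc) = (bx = cx)))
      + of_bool (\<not> ((ta = tb) = (ay = by) \<and> (tb = tc) = (by = cy))) :: nat)" for ta tb tc :: bool
  have star: "\<exists>k\<in>S. k \<le> r ta tb tc" for ta tb tc
  proof -
    obtain tx where
      "of_bool ((ta = tx) = ax) + of_bool ((tb = tx) = bx) + of_bool ((tc = tx) = cx)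
        \<le> (of_bool (\<not> ((ta = tb) = (ax = bx) \<and> (tb = tc) = (bx = cx))) :: nat)"
      using switch_star_bool[of ta ax tb bx tc cx] ..
    moreover obtain ty where
      "of_bool ((ta = ty) = ay) + of_bool ((tb = ty) = by) + of_bool ((tc = ty) = cy)
        \<le> (of_bool (\<not> ((ta = tb) = (ay = by) \<and> (tb = tc) = (by = cy))) :: nat)"
      using switch_star_bool[of ta ay tb "by" tc cy] ..
    ultimately show ?thesis
      unfolding r_def by (intro bexI[OF _ S[of ta tb tc tx ty]] add_mono order_refl)
  qed
  \<comment> \<open>The conditions say that the triangles are negative. Placing \<open>a\<close> on
    side \<open>True\<close> and every other vertex on the side given by its edge to
    \<open>a\<close> then frustrates all nine edges.\<close>
  have "9 \<in> S"
    if "(ab = bc) = ac" "ab = (ax = bx)" "bc = (bx = cx)" "ab = (ay = by)" "bc = (by = cy)"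
  proof -
    have "(ab = ac) = bc" "(ab = ax) = bx" "(ac = ax) = cx" "(ab = ay) = by" "(ac = ay) = cy"
      using that by argo+
    then show ?thesis
      using S[of True ab ac ax ay] by (simp add: numeral_eq_Suc)
  qed
  moreover have "(\<exists>ta tb tc. r ta tb tc \<le> 2) \<or> (\<exists>ta tb tc. r ta tb tc \<le> 3) \<and>
     ((ab = bc) = ac \<and> ab = (ax = bx) \<and> bc = (bx = cx) \<and> ab = (ay = by) \<and> bc = (by = cy))"
    unfolding r_def by (rule switch_triangle_bool)
  moreover have "\<exists>l\<in>S. l \<le> k" if "\<exists>ta tb tc. r ta tb tc \<le> k" for k
  proof -
    obtain ta tb tc where "r ta tb tc \<le> k"
      using \<open>\<exists>ta tb tc. r ta tb tc \<le> k\<close> by (elim exE)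
    then show ?thesis
      using star[of ta tb tc] by (auto intro: le_trans)
  qed
  ultimately show ?thesis
    by blast
qed

text \<open>The sides of the five vertices turn the counts into those of
  \<open>switch_S3_bool\<close>. A count of 9 means that some switching makes every edge negative,
  hence every triangle is negative.\<close>

lemma ex_switching_S3:
  assumes "card A = 3" "A \<inter> B = {}" "card B = 2"
    and sign: "\<And>e. e \<in> split_edges A B \<Longrightarrow> \<sigma> e \<in> {1, -1}"
  shows "\<exists>X. card (frustrated_edges (split_edges A B) \<sigma> X)
           \<le> (if triangles_negative (split_edges A B) \<sigma> then 3 else 2)"
proof -
  obtain a b c where A: "A = {a, b, c}" and abc: "a \<noteq> b" "a \<noteq> c" "b \<noteq> c"
    using assms(1) by (auto simp: card_3_iff)
  obtain x y where B: "B = {x, y}" and xy: "x \<noteq> y"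
    using assms(3) by (auto simp: card_2_iff)
  have disj: "x \<notin> {a, b, c}" "y \<notin> {a, b, c}"
    using assms(2) A B by auto
  let ?E = "split_edges A B"
  have E: "?E = {{a, b}, {a, c}, {b, c}, {a, x}, {b, x}, {c, x}, {a, y}, {b, y}, {c, y}}"
    (is "_ = ?E'")
  proof (intro equalityI subsetI)
    fix e assume "e \<in> ?E"
    then show "e \<in> ?E'"
      by (rule split_edgesE) (auto simp: A B doubleton_eq_iff)
  next
    fix e assume "e \<in> ?E'"
    then show "e \<in> ?E"
      using abc disj by (auto simp: A B doubleton_in_split_edges)
  qed
  \<comment> \<open>A distinct list of the edges turns the cardinality into an explicit sum of nine
    terms.\<close>
  let ?L = "[{a, b}, {a, c}, {b, c}, {a, x}, {b, x}, {c, x}, {a, y}, {b, y}, {c, y}]"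
  have L: "distinct ?L" "set ?L = ?E"
    using abc disj xy E by (auto simp: doubleton_eq_iff)
  define neg where "neg e \<longleftrightarrow> \<sigma> e = -1" for e
  have switch_neg: "switch X \<sigma> {p, q} = -1 \<longleftrightarrow> ((p \<in> X) = (q \<in> X)) = neg {p, q}"
    if "{p, q} \<in> ?E" for p q X
    using that sign[OF that] by (auto simp: switch_edge neg_def doubleton_in_split_edges)
  have count: "of_bool ((ta = tb) = neg {a, b}) + of_bool ((ta = tc) = neg {a, c})
    + of_bool ((tb = tc) = neg {b, c})
    + (of_bool ((ta = tx) = neg {a, x}) + of_bool ((tb = tx) = neg {b, x})
      + of_bool ((tc = tx) = neg {c, x}))
    + (of_bool ((ta = ty) = neg {a, y}) + of_bool ((tb = ty) = neg {b, y})
      + of_bool ((tc = ty) = neg {c, y}))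
    \<in> range (\<lambda>X. card (frustrated_edges ?E \<sigma> X))" for ta tb tc tx ty :: bool
  proof -
    define X where "X = {v. v = a \<and> ta \<or> v = b \<and> tb \<or> v = c \<and> tc \<or> v = x \<and> tx \<or> v = y \<and> ty}"
    have X: "a \<in> X \<longleftrightarrow> ta" "b \<in> X \<longleftrightarrow> tb" "c \<in> X \<longleftrightarrow> tc" "x \<in> X \<longleftrightarrow> tx" "y \<in> X \<longleftrightarrow> ty"
      using abc disj xy by (auto simp: X_def)
    have "frustrated_edges ?E \<sigma> X = ?E \<inter> {e. switch X \<sigma> e = -1}"
      by (auto simp: frustrated_edges_def)
    then have "card (frustrated_edges ?E \<sigma> X) = (\<Sum>e\<in>?E. of_bool (switch X \<sigma> e = -1))"
      using finite_set[of ?L] unfolding L(2) by simp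
    also have "\<dots> = (\<Sum>e\<leftarrow>?L. of_bool (switch X \<sigma> e = -1))"
      using sum.distinct_set_conv_list[OF L(1)] unfolding L(2) .
    finally show ?thesis
      by (intro image_eqI[of _ _ X]) (simp_all add: switch_neg E X)
  qed
  have cardE: "card ?E = 9"
    using distinct_card[OF L(1)] L(2) by simp
  have tri: "triangles_negative ?E \<sigma>" if "card (frustrated_edges ?E \<sigma> X) = 9" for X
  proof (rule triangles_negative_if_switch)
    have "frustrated_edges ?E \<sigma> X = ?E"
    proof (rule card_subset_eq)
      show "finite ?E"
        using cardE by (simp add: card_ge_0_finite)
    qed (use that cardE in \<open>auto simp: frustrated_edges_def\<close>)
    then show "\<And>e. e \<in> ?E \<Longrightarrow> switch X \<sigma> e = -1"
      by (auto simp: frustrated_edges_def)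
  qed (auto simp: split_edges_def)
  have "\<exists>X. card (frustrated_edges ?E \<sigma> X) \<le> 2
    \<or> card (frustrated_edges ?E \<sigma> X) \<le> 3 \<and> triangles_negative ?E \<sigma>"
    using switch_S3_bool[OF count] tri[OF sym] unfolding bex_simps(7) image_iff by blast
  then obtain X where "card (frustrated_edges ?E \<sigma> X) \<le> 2
    \<or> card (frustrated_edges ?E \<sigma> X) \<le> 3 \<and> triangles_negative ?E \<sigma>" ..
  then have "card (frustrated_edges ?E \<sigma> X) \<le> (if triangles_negative ?E \<sigma> then 3 else 2)"
    by auto
  then show ?thesis ..
qed

section \<open>Induction on the number of clique vertices\<close>

text \<open>A restored clique vertex has \<open>n + 2\<close> neighbours and costs at most
  \<open>(n + 2) div 2\<close>. This is exactly the growth of the bound, so a deficit of one is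
  carried through the induction.\<close>

lemma bound_Suc:
  assumes "3 \<le> n"
  shows "(n + 1)\<^sup>2 div 4 - 1 + (n + 2) div 2 = (Suc n + 1)\<^sup>2 div 4 - (1::nat)"
proof -
  have "(n + 1)\<^sup>2 div 4 + (n + 2) div 2 = (Suc n + 1)\<^sup>2 div 4"
  proof (cases "even n")
    case True
    then obtain k where "n = 2 * k" by blast
    then show ?thesis
      by (simp add: power2_eq_square algebra_simps)
  next
    case False
    then obtain k where "n = 2 * k + 1" by (auto elim: oddE)
    then show ?thesis
      by (simp add: power2_eq_square algebra_simps)
  qed
  moreover have "4\<^sup>2 \<le> (n + 1)\<^sup>2"
    using assms by (intro power_mono) auto
  then have "1 \<le> (n + 1)\<^sup>2 div 4"
    by (simp add: less_eq_div_iff_mult_less_eq)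
  ultimately show ?thesis by linarith
qed

text \<open>The \<open>of_bool\<close> term strengthens the induction: a signature with a triangle
  that is not negative stays strictly below the bound, which later gives uniqueness.\<close>

lemma ex_switching:
  assumes "3 \<le> card A" "A \<inter> B = {}" "card B = 2"
    and "\<And>e. e \<in> split_edges A B \<Longrightarrow> \<sigma> e \<in> {1, -1}"
  shows "\<exists>X. card (frustrated_edges (split_edges A B) \<sigma> X)
             + of_bool (\<not> triangles_negative (split_edges A B) \<sigma>) \<le> (card A + 1)\<^sup>2 div 4 - 1"
  using assms
proof (induction "card A" arbitrary: A rule: nat_induct_at_least)
  case base
  then show ?case
    using ex_switching_S3[of A B \<sigma>] by (auto split: if_splits)
next
  case (Suc n)
  have fin: "finite A" "finite B"
    using Suc by (auto intro: card_ge_0_finite)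
  have "\<exists>u\<in>A. triangles_negative (split_edges (A - {u}) B) \<sigma> \<longrightarrow> triangles_negative (split_edges A B) \<sigma>"
  proof (cases "triangles_negative (split_edges A B) \<sigma>")
    case True
    have "A \<noteq> {}" using Suc by auto
    then show ?thesis using True by blast
  next
    case False
    then obtain p q r where pqr: "{p, q} \<in> split_edges A B" "{q, r} \<in> split_edges A B"
      "{p, r} \<in> split_edges A B" "\<sigma> {p, q} * \<sigma> {q, r} * \<sigma> {p, r} \<noteq> -1"
      by (auto simp: triangles_negative_def)
    have "card {p, q, r} \<le> 3"
      by (simp add: card_insert_if)
    \<comment> \<open>Here \<open>A\<close> has at least four vertices, so some clique vertex lies
      off the bad triangle; deleting it keeps that triangle and hence the deficit.\<close>
    then have "\<not> A \<subseteq> {p, q, r}"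
      using Suc card_mono[of "{p, q, r}" A] by auto
    then obtain u where u: "u \<in> A" "u \<notin> {p, q, r}" by auto
    then have "\<not> triangles_negative (split_edges (A - {u}) B) \<sigma>"
      using pqr by (auto simp: triangles_negative_def doubleton_in_split_edges)
    then show ?thesis using u by blast
  qed
  then obtain u where u: "u \<in> A" and
    tri: "triangles_negative (split_edges (A - {u}) B) \<sigma> \<Longrightarrow> triangles_negative (split_edges A B) \<sigma>"
    by blast
  have A: "insert u (A - {u}) = A"
    using u by auto
  have cardA: "card (A - {u}) = n"
    using u fin Suc by simp
  have uB: "u \<notin> B"
    using u Suc by auto
  have sub: "split_edges (A - {u}) B \<subseteq> split_edges A B"
    by (auto simp: split_edges_def)
  obtain X where X: "card (frustrated_edges (split_edges (A - {u}) B) \<sigma> X)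
      + of_bool (\<not> triangles_negative (split_edges (A - {u}) B) \<sigma>) \<le> (n + 1)\<^sup>2 div 4 - 1"
    using Suc.hyps(2)[of "A - {u}"] Suc.prems cardA Suc.hyps(1) sub by auto
  obtain Y where Y: "card (frustrated_edges (split_edges A B) \<sigma> Y)
      \<le> card (frustrated_edges (split_edges (A - {u}) B) \<sigma> X) + card ((A - {u}) \<union> B) div 2"
    using extend_switching[of "A - {u}" B u \<sigma> X, unfolded A] fin uB Suc.prems(3) by blast
  have "card ((A - {u}) \<union> B) = n + 2"
    using fin Suc.prems cardA by (subst card_Un_disjoint) auto
  moreover have "of_bool (\<not> triangles_negative (split_edges A B) \<sigma>)
      \<le> (of_bool (\<not> triangles_negative (split_edges (A - {u}) B) \<sigma>) :: nat)"
    using tri by auto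
  ultimately have "card (frustrated_edges (split_edges A B) \<sigma> Y)
      + of_bool (\<not> triangles_negative (split_edges A B) \<sigma>)
      \<le> (n + 1)\<^sup>2 div 4 - 1 + (n + 2) div 2"
    using X Y by linarith
  then have "card (frustrated_edges (split_edges A B) \<sigma> Y)
      + of_bool (\<not> triangles_negative (split_edges A B) \<sigma>) \<le> (card A + 1)\<^sup>2 div 4 - 1"
    using bound_Suc[OF Suc.hyps(1)] Suc.hyps(3) by metis
  then show ?case ..
qed

section \<open>From negative triangles to switching equivalence\<close>

text \<open>Switching the vertices joined to \<open>a\<close> by a positive edge makes all edges at
  \<open>a\<close> negative. As \<open>a\<close> is adjacent to every other vertex, each remaining
  edge closes a negative triangle with \<open>a\<close> and so becomes negative too.\<close>

lemma switching_equivalent_if_triangles_negative: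
  assumes "a \<in> A" "a \<notin> B" "verts G = A \<union> B" "edges G = split_edges A B"
    and sign: "signature G \<sigma>" and tri: "triangles_negative (edges G) \<sigma>"
  shows "switching_equivalent G \<sigma> all_negative"
proof -
  define X where "X = {v \<in> verts G. v \<noteq> a \<and> \<sigma> {a, v} = 1}"
  have "switch X \<sigma> e = -1" if e: "e \<in> edges G" for e
  proof -
    obtain p q where pq: "e = {p, q}" "p \<noteq> q" "p \<in> A - B" "q \<in> A \<union> B"
      using e assms(4) by (auto elim: split_edgesE)
    have \<sigma>: "\<sigma> {a, v} \<in> {1, -1}" if "v \<in> verts G" "v \<noteq> a" for v
      using that sign assms by (auto simp: signature_def doubleton_in_split_edges)
    consider "p = a" | "q = a" | "p \<noteq> a" "q \<noteq> a" by blast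
    then show ?thesis
    proof cases
      case 1
      then show ?thesis
        using pq \<sigma>[of q] assms(3) by (auto simp: switch_edge X_def)
    next
      case 2
      then show ?thesis
        using pq \<sigma>[of p] assms(3) by (auto simp: switch_edge X_def insert_commute)
    next
      case 3
      then have "\<sigma> {a, p} * \<sigma> {p, q} * \<sigma> {a, q} = -1"
        using pq assms by (intro triangle_negativeD[OF tri]) (auto simp: doubleton_in_split_edges)
      then show ?thesis
        using pq 3 \<sigma>[of p] \<sigma>[of q] assms(3) by (auto simp: switch_edge X_def)
    qed
  qed
  then show ?thesis
    by (auto simp: switching_equivalent_def all_negative_def X_def intro!: exI[of _ X])
qed

section \<open>Lower bound\<close>

lemma balanced_all_negative_triangle_free:
  assumes "balanced G all_negative" "\<And>e. e \<in> edges G \<Longrightarrow> e \<subseteq> verts G \<and> card e = 2"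
    and "{p, q} \<in> edges G" "{q, r} \<in> edges G"
  shows "{p, r} \<notin> edges G"
proof
  assume pr: "{p, r} \<in> edges G"
  have ne: "p \<noteq> q" "q \<noteq> r" "p \<noteq> r"
    using assms(2)[OF assms(3)] assms(2)[OF assms(4)] assms(2)[OF pr] by auto
  let ?vs = "[p, q, r]"
  have "cycle_edges ?vs = (\<lambda>i. {?vs ! i, ?vs ! (Suc i mod 3)}) ` {..<3}"
    by (auto simp: cycle_edges_def)
  also have "{..<3} = {0, 1, 2::nat}"
    by auto
  finally have ce: "cycle_edges ?vs = {{p, q}, {q, r}, {p, r}}"
    by (simp add: insert_commute[of r p])
  have "is_cycle G ?vs"
    using ne assms pr by (auto simp: is_cycle_def ce)
  then have "cycle_sign all_negative ?vs = 1"
    using assms(1) by (auto simp: balanced_def)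
  then show False
    using ne by (simp add: cycle_sign_def ce all_negative_def doubleton_eq_iff)
qed

text \<open>The number of edges a complete graph on \<open>n + 2\<close> vertices must lose to reach
  Mantel's bound.\<close>

lemma choose_two_diff_square: "(n + 2 choose 2) - (n + 2)\<^sup>2 div 4 = (n + 1)\<^sup>2 div (4::nat)"
proof (cases "even n")
  case True
  then obtain k where "n = 2 * k" by blast
  then show ?thesis
    by (simp add: choose_two power2_eq_square algebra_simps)
next
  case False
  then obtain k where "n = 2 * k + 1" by (auto elim: oddE)
  then show ?thesis
    by (simp add: choose_two power2_eq_square algebra_simps)
qed

text \<open>Mantel's bound for the graph left by \<open>F\<close> forces \<open>F\<close> to contain
  the excess edges; the \<open>- 1\<close> comes from the one pair missing in
  \<open>card_split_edges\<close>.\<close>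

lemma card_frustration_all_negative:
  assumes "finite A" "A \<inter> B = {}" "card B = 2" "verts G = A \<union> B" "edges G = split_edges A B"
    and F: "F \<subseteq> edges G" "balanced (delete_edges G F) all_negative"
  shows "(card A + 1)\<^sup>2 div 4 - 1 \<le> card F"
proof -
  have B: "finite B"
    using assms(3) by (simp add: card_ge_0_finite)
  have fin: "finite (edges G)"
    using assms B by (simp add: finite_split_edges)
  have "4 * card (edges G - F) \<le> (card (A \<union> B))\<^sup>2"
  proof (rule mantel)
    fix e assume "e \<in> edges G - F"
    then show "e \<subseteq> A \<union> B \<and> card e = 2"
      using assms(5) by (auto simp: split_edges_def)
  next
    fix p q r assume "{p, q} \<in> edges G - F" "{q, r} \<in> edges G - F"
    then show "{p, r} \<notin> edges G - F"
      using balanced_all_negative_triangle_free[OF F(2), of p q r] assms(4,5)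
      by (auto simp: delete_edges_def split_edges_def)
  qed (use assms(1) B in auto)
  moreover have "card (A \<union> B) = card A + 2"
    using assms B by (simp add: card_Un_disjoint)
  moreover have "card (edges G - F) = card (edges G) - card F"
    using F fin by (meson card_Diff_subset finite_subset)
  moreover have "card (edges G) = (card A + 2 choose 2) - 1"
    using assms by (simp add: card_split_edges)
  ultimately have "(card A + 2 choose 2) - 1 - card F \<le> (card A + 2)\<^sup>2 div 4"
    by (simp add: less_eq_div_iff_mult_less_eq mult.commute)
  then show ?thesis
    using choose_two_diff_square[of "card A"] by linarith
qed

theorem theorem31:
  fixes n :: nat
  assumes "n \<ge> 3"
  shows "all_negative_maximises_uniquely (complete_split_graph n 2) \<and>
         max_frustration_index (complete_split_graph n 2)
           = frustration_index (complete_split_graph n 2) all_negative \<and>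
         int (frustration_index (complete_split_graph n 2) all_negative)
           = \<lfloor>(real n - 1)\<^sup>2 / 4 + real n - 1\<rfloor>"
proof -
  define A :: "(nat + nat) set" where "A = Inl ` {..<n}"
  define B :: "(nat + nat) set" where "B = Inr ` {..<2::nat}"
  \<comment> \<open>Since \<open>(n - 1)^2 / 4 + n - 1 = (n + 1)^2 / 4 - 1\<close>, this is the
    claimed value in natural arithmetic.\<close>
  define m where "m = (n + 1)\<^sup>2 div 4 - 1"
  let ?G = "complete_split_graph n 2"
  have AB: "finite A" "finite B" "card A = n" "card B = 2" "A \<inter> B = {}"
    by (auto simp: A_def B_def card_image)
  have G: "verts ?G = A \<union> B" "edges ?G = split_edges A B"
    by (simp_all add: A_def B_def verts_complete_split_graph edges_complete_split_graph)
  have fin: "finite (edges ?G)"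
    using AB G by (simp add: finite_split_edges)
  have upper: "frustration_index ?G \<sigma> + of_bool (\<not> triangles_negative (edges ?G) \<sigma>) \<le> m"
    if "signature ?G \<sigma>" for \<sigma>
  proof -
    have "\<sigma> e \<in> {1, -1}" if "e \<in> split_edges A B" for e
      using that \<open>signature ?G \<sigma>\<close> G by (simp add: signature_def)
    then have "\<exists>X. card (frustrated_edges (edges ?G) \<sigma> X)
        + of_bool (\<not> triangles_negative (edges ?G) \<sigma>) \<le> m"
      using ex_switching[OF _ AB(5,4)] assms unfolding G m_def AB(3) by blast
    then obtain X where "card (frustrated_edges (edges ?G) \<sigma> X)
        + of_bool (\<not> triangles_negative (edges ?G) \<sigma>) \<le> m" ..
    then show ?thesis
      using frustration_index_le[OF fin that, of X] by linarith
  qed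
  have neg: "signature ?G all_negative"
    by (simp add: signature_def all_negative_def)
  have "m \<le> frustration_index ?G all_negative"
  proof -
    obtain F where "F \<subseteq> edges ?G" "balanced (delete_edges ?G F) all_negative"
      "frustration_index ?G all_negative = card F"
      using frustration_index_attained[OF fin neg] .
    then show ?thesis
      using card_frustration_all_negative[of A B ?G F] AB G by (simp add: m_def)
  qed
  then have l_neg: "frustration_index ?G all_negative = m"
    using upper[OF neg] by linarith
  have "max_frustration_index ?G = m"
    unfolding max_frustration_index_def
  proof (rule Max_eqI)
    have "{frustration_index ?G \<sigma> | \<sigma>. signature ?G \<sigma>} \<subseteq> {..m}"
      using upper by fastforce
    then show "finite {frustration_index ?G \<sigma> | \<sigma>. signature ?G \<sigma>}"
      by (rule finite_subset) simp
  next
    fix k assume "k \<in> {frustration_index ?G \<sigma> | \<sigma>. signature ?G \<sigma>}"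
    then show "k \<le> m"
      using upper by fastforce
  next
    show "m \<in> {frustration_index ?G \<sigma> | \<sigma>. signature ?G \<sigma>}"
      using neg l_neg by blast
  qed
  moreover have "switching_equivalent ?G \<sigma> all_negative"
    if "signature ?G \<sigma>" "frustration_index ?G \<sigma> = m" for \<sigma>
  proof (rule switching_equivalent_if_triangles_negative)
    show "triangles_negative (edges ?G) \<sigma>"
      \<comment> \<open>Attaining \<open>m\<close> leaves no room for the \<open>of_bool\<close>
        term in \<open>upper\<close>.\<close>
      using upper[OF that(1)] that(2) by (auto split: if_splits)
    show "Inl 0 \<in> A" "Inl 0 \<notin> B"
      using assms by (auto simp: A_def B_def)
  qed (use G that in auto)
  moreover have "int m = \<lfloor>(real n - 1)\<^sup>2 / 4 + real n - 1\<rfloor>"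
  proof -
    \<comment> \<open>Ensures that the truncated subtraction in \<open>m\<close> agrees with
      subtraction of integers.\<close>
    have "4\<^sup>2 \<le> (n + 1)\<^sup>2"
      using assms by (intro power_mono) auto
    then have "1 \<le> (n + 1)\<^sup>2 div 4"
      by (simp add: less_eq_div_iff_mult_less_eq)
    then have "int m = int ((n + 1)\<^sup>2) div int 4 - 1"
      by (simp add: m_def of_nat_diff zdiv_int)
    also have "\<dots> = \<lfloor>real ((n + 1)\<^sup>2) / real 4\<rfloor> - 1"
      by (simp only: floor_divide_of_nat_eq zdiv_int)
    also have "\<dots> = \<lfloor>real ((n + 1)\<^sup>2) / real 4 - 1\<rfloor>"
      by simp
    also have "real ((n + 1)\<^sup>2) / real 4 - 1 = (real n - 1)\<^sup>2 / 4 + real n - 1"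
      by (simp add: power2_eq_square field_simps)
    finally show ?thesis .
  qed
  ultimately show ?thesis
    using l_neg by (simp add: all_negative_maximises_uniquely_def)
qed

end
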